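(* Suppose $(u^*,\alpha^* )$, with $u^*:S\to\mathbb{R}$ and $\alpha^*\in[0,1]$, satisfies both $$u^*(s)=\sup_{\phi\in Q}\inf_{p_s\in\mathcal{P}_s}\sum_{a\in A}\sum_{s'\in S}\phi(a)p_s(s'|a)\big[r(s,a)-\alpha^*+u^*(s')\big]\qquad\forall s\in S$$ and $$u^*(s)=\inf_{p_s\in\mathcal{P}_s}\sup_{\phi\in Q}\sum_{a\in A}\sum_{s'\in S}\phi(a)p_s(s'|a)\big[r(s,a)-\alpha^*+u^*(s')\big]\qquad\forall s\in S.$$ Then for every combination of $\Pi\in\{\Pi_H,\Pi_S\}$ and $K\in\{K_H,K_S\}$ and every $\mu\in\mathrm{Prob}(S)$, $$\sup_{\pi\in\Pi}\inf_{\kappa\in K}\overline\alpha(\mu,\pi,\kappa)=\inf_{\kappa\in K}\sup_{\pi\in\Pi}\overline\alpha(\mu,\pi,\kappa)=\sup_{\pi\in\Pi}\inf_{\kappa\in K}\underline\alpha(\mu,\pi,\kappa)=\inf_{\kappa\in K}\sup_{\pi\in\Pi}\underline\alpha(\mu,\pi,\kappa)=\alpha^*.$$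
   Context: $S$ (states) and $A$ (actions) are finite nonempty sets; $\mathrm{Prob}(E)$ is the set of probability distributions on a finite set $E$; $r:S\times A\to[0,1]$ is a reward function. $Q\subseteq\mathrm{Prob}(A)$ is an arbitrary nonempty set (controller's admissible randomized actions). For each $s\in S$, $\mathcal{P}_s$ is an arbitrary nonempty set of maps $p_s:A\to\mathrm{Prob}(S)$, written $p_s(s'|a)$; $\mathcal{P}=\prod_{s\in S}\mathcal{P}_s$ is the (S-rectangular) ambiguity set, and $p\in\mathcal{P}$ is written $p(s'|s,a)=p_s(s'|a)$. Histories: $h_t=(s_0,a_0,\dots,s_{t-1},a_{t-1},s_t)\in(S\times A)^t\times S$. $\Pi_H$ is the set of history-dependent controller policies $\pi=(\pi_0,\pi_1,\dots)$ with $\pi_t(\cdot|h_t)\in Q$ for all $t,h_t$. $\Pi_S\subseteq\Pi_H$ is the set of stationary ones, $\pi_t(\cdot|h_t)=\Delta(\cdot|s_t)$ for a single map $\Delta:S\to Q$. $K_H$ is the set of history-dependent adversary policies $\kappa=(\kappa_0,\kappa_1,\dots)$ where $\kappa_t(s'|h_t,a)$ is such that $\kappa_t(\cdot|h_t,\cdot)\in\mathcal{P}_{s_t}$ for all $t$, $h_t$. $K_S\subseteq K_H$ is the set of stationary ones, $\kappa_t(s'|h_t,a)=p(s'|s_t,a)$ for a single $p\in\mathcal{P}$. For $\mu\in\mathrm{Prob}(S)$, $\pi$, $\kappa$, $E_\mu^{\pi,\kappa}$ is expectation under the law of $(X_0,A_0,X_1,A_1,\dots)$ with $X_0\sim\mu$,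 $A_t\sim\pi_t(\cdot|H_t)$ given $H_t=(X_0,A_0,\dots,X_t)$, and $X_{t+1}\sim\kappa_t(\cdot|H_t,A_t)$ given $(H_t,A_t)$. Define $$\overline\alpha(\mu,\pi,\kappa)=\limsup_{n\to\infty}E_\mu^{\pi,\kappa}\frac1n\sum_{k=0}^{n-1}r(X_k,A_k),\quad \underline\alpha(\mu,\pi,\kappa)=\liminf_{n\to\infty}E_\mu^{\pi,\kappa}\frac1n\sum_{k=0}^{n-1}r(X_k,A_k).$$ *)

theory Defs
  imports "HOL-Probability.Probability"
begin

text \<open>
  A history \<open>(s\<^sub>0, a\<^sub>0, \<dots>, s\<^sub>t\<^sub>-\<^sub>1, a\<^sub>t\<^sub>-\<^sub>1, s\<^sub>t)\<close> is a pair of the list of past state-action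
  pairs and the current state. The length of the list is the time \<open>t\<close>, so that a function on
  histories is a whole sequence of time-dependent decision rules.
\<close>

type_synonym ('s, 'a) history = "('s \<times> 'a) list \<times> 's"
type_synonym ('s, 'a) policy = "('s, 'a) history \<Rightarrow> 'a pmf"
type_synonym ('s, 'a) adversary = "('s, 'a) history \<Rightarrow> 'a \<Rightarrow> 's pmf"

definition history_policies :: "'a pmf set \<Rightarrow> ('s, 'a) policy set" where
  "history_policies Q = {\<pi>. \<forall>h. \<pi> h \<in> Q}"

definition stationary_policies :: "'a pmf set \<Rightarrow> ('s, 'a) policy set" where
  "stationary_policies Q = {\<lambda>h. \<Delta> (snd h) | \<Delta>. \<forall>s. \<Delta> s \<in> Q}"

definition history_adversaries :: "('s \<Rightarrow> ('a \<Rightarrow> 's pmf) set) \<Rightarrow> ('s, 'a) adversary set" where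
  "history_adversaries P = {\<kappa>. \<forall>h. \<kappa> h \<in> P (snd h)}"

text \<open>\<open>Pi UNIV P\<close> is the S-rectangular ambiguity set.\<close>

definition stationary_adversaries :: "('s \<Rightarrow> ('a \<Rightarrow> 's pmf) set) \<Rightarrow> ('s, 'a) adversary set" where
  "stationary_adversaries P = {\<lambda>h. p (snd h) | p. p \<in> Pi UNIV P}"

text \<open>
  A trajectory is a function \<open>\<omega>\<close> with \<open>\<omega> t = (X\<^sub>t, A\<^sub>t)\<close>. The two functions below give the
  conditional laws of \<open>X\<^sub>t\<close> and of \<open>(X\<^sub>t, A\<^sub>t)\<close> given \<open>\<omega> 0, \<dots>, \<omega> (t - 1)\<close>; they use no other
  values of \<open>\<omega>\<close>.
\<close>

primrec next_state :: "'s pmf \<Rightarrow> ('s, 'a) adversary \<Rightarrow> nat \<Rightarrow> (nat \<Rightarrow> 's \<times> 'a) \<Rightarrow> 's pmf" where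
  "next_state \<mu> \<kappa> 0 \<omega> = \<mu>"
| "next_state \<mu> \<kappa> (Suc t) \<omega> = \<kappa> (map \<omega> [0..<t], fst (\<omega> t)) (snd (\<omega> t))"

definition step ::
  "'s pmf \<Rightarrow> ('s, 'a) policy \<Rightarrow> ('s, 'a) adversary \<Rightarrow> nat \<Rightarrow> (nat \<Rightarrow> 's \<times> 'a) \<Rightarrow> ('s \<times> 'a) pmf" where
  "step \<mu> \<pi> \<kappa> t \<omega> =
     bind_pmf (next_state \<mu> \<kappa> t \<omega>) (\<lambda>x.
       map_pmf (Pair x) (\<pi> (map \<omega> [0..<t], x)))"

global_interpretation IT: Ionescu_Tulcea
  "\<lambda>t \<omega>. measure_pmf (step \<mu> \<pi> \<kappa> t \<omega>)" "\<lambda>_. count_space (UNIV :: ('s::finite \<times> 'a::finite) set)"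
  for \<mu> :: "'s::finite pmf" and \<pi> :: "('s, 'a::finite) policy" and \<kappa> :: "('s, 'a) adversary"
proof
  fix t :: nat
  show "(\<lambda>\<omega>. measure_pmf (step \<mu> \<pi> \<kappa> t \<omega>)) \<in>
    measurable (PiM {0..<t} (\<lambda>_. count_space UNIV)) (subprob_algebra (count_space UNIV))"
    by (simp add: count_space_PiM_finite measure_pmf_in_subprob_algebra)
qed

text \<open>The law of \<open>(X\<^sub>0, A\<^sub>0, X\<^sub>1, A\<^sub>1, \<dots>)\<close>, by the Ionescu-Tulcea theorem.\<close>

definition traj_law ::
  "'s::finite pmf \<Rightarrow> ('s, 'a::finite) policy \<Rightarrow> ('s, 'a) adversary \<Rightarrow> (nat \<Rightarrow> 's \<times> 'a) measure" where
  "traj_law \<mu> \<pi> \<kappa> = IT.PF.lim \<mu> \<pi> \<kappa>"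

definition mean_reward ::
  "('s::finite \<Rightarrow> 'a::finite \<Rightarrow> real) \<Rightarrow> 's pmf \<Rightarrow> ('s, 'a) policy \<Rightarrow> ('s, 'a) adversary \<Rightarrow> nat \<Rightarrow> real" where
  "mean_reward r \<mu> \<pi> \<kappa> n =
     (\<integral>\<omega>. 1 / real n * (\<Sum>k<n. r (fst (\<omega> k)) (snd (\<omega> k))) \<partial>traj_law \<mu> \<pi> \<kappa>)"

definition upper_avg ::
  "('s::finite \<Rightarrow> 'a::finite \<Rightarrow> real) \<Rightarrow> 's pmf \<Rightarrow> ('s, 'a) policy \<Rightarrow> ('s, 'a) adversary \<Rightarrow> ereal" where
  "upper_avg r \<mu> \<pi> \<kappa> = limsup (\<lambda>n. ereal (mean_reward r \<mu> \<pi> \<kappa> n))"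

definition lower_avg ::
  "('s::finite \<Rightarrow> 'a::finite \<Rightarrow> real) \<Rightarrow> 's pmf \<Rightarrow> ('s, 'a) policy \<Rightarrow> ('s, 'a) adversary \<Rightarrow> ereal" where
  "lower_avg r \<mu> \<pi> \<kappa> = liminf (\<lambda>n. ereal (mean_reward r \<mu> \<pi> \<kappa> n))"

end

theory Submission
  imports Defs
begin

text \<open>
  Write \<open>T s \<phi> p = E\<^sub>\<phi> (r s a + E\<^sub>p\<^sub>a u)\<close> for the reward of one step plus the expected potential \<open>u\<close>
  of the state it leads to. The two equations say that \<open>u s + \<alpha>\<close> is the value of the one-step game
  with payoff \<open>T s\<close>, whichever player moves first. Suprema and infima need not be attained, so
  for \<open>\<epsilon> > 0\<close> the first equation gives the controller a map \<open>\<Delta> : S \<rightarrow> Q\<close> with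
  \<open>T s (\<Delta> s) p \<ge> u s + \<alpha> - \<epsilon>\<close> for every \<open>p \<in> P s\<close>, and the second gives the adversary a kernel
  that keeps \<open>T s\<close> below \<open>u s + \<alpha> + \<epsilon>\<close> for every \<open>\<phi> \<in> Q\<close>
  (\<open>near_optimal_SUP_INF\<close>, \<open>near_optimal_INF_SUP\<close>).

  These stationary choices are good against every history-dependent opponent. The reason is
  rectangularity: after any history the opponent's decision rule is still a point of
  \<open>P s\<close> (or of \<open>Q\<close>), where \<open>s\<close> is the current state. If the controller plays \<open>\<Delta>\<close>, then
  \<open>E (\<Sum>k<n. r X\<^sub>k A\<^sub>k) + E (u X\<^sub>n)\<close> grows by at least \<open>\<alpha> - \<epsilon>\<close> in each step (\<open>drift_step\<close>).
  Telescoping, and dividing by \<open>n\<close>, makes the bounded potential disappear, so that even the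
  lower limit of the mean rewards is at least \<open>\<alpha> - \<epsilon>\<close> (\<open>drift_lower_avg\<close>). The adversary's
  bound on the upper limit follows by negating \<open>r\<close> and \<open>u\<close> (\<open>drift_upper_avg\<close>).

  Since every policy class lies between the stationary and the history-dependent ones, this
  gives \<open>\<alpha> \<le> sup inf liminf\<close> and \<open>inf sup limsup \<le> \<alpha>\<close> for all four combinations of classes. The
  four quantities of the theorem lie between these two by \<open>sup inf \<le> inf sup\<close> and
  \<open>liminf \<le> limsup\<close>.

  The drift computation conditions on the past. To do this with finite sums only, the
  Ionescu-Tulcea law is replaced by the laws of its finite prefixes, which are probability mass
  functions on lists (\<open>distr_traj_law\<close>).
\<close>

section \<open>The law of finite trajectory prefixes\<close>

primrec path_law ::
  "'s pmf \<Rightarrow> ('s, 'a) policy \<Rightarrow> ('s, 'a) adversary \<Rightarrow> nat \<Rightarrow> ('s \<times> 'a) list pmf" where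
  "path_law \<mu> \<pi> \<kappa> 0 = return_pmf []"
| "path_law \<mu> \<pi> \<kappa> (Suc t) =
     bind_pmf (path_law \<mu> \<pi> \<kappa> t) (\<lambda>l. map_pmf (\<lambda>y. l @ [y]) (step \<mu> \<pi> \<kappa> t ((!) l)))"

text \<open>
  The decision rules take functions on all of \<open>\<nat>\<close>. The next two lemmas allow the actual past to be
  replaced by \<open>(!) l\<close>, where \<open>l\<close> is the list of its first \<open>t\<close> entries.
\<close>

lemma next_state_cong:
  assumes "\<And>i. i < t \<Longrightarrow> \<omega> i = \<omega>' i"
  shows "next_state \<mu> \<kappa> t \<omega> = next_state \<mu> \<kappa> t \<omega>'"
proof (cases t)
  case (Suc n)
  then have "map \<omega> [0..<n] = map \<omega>' [0..<n]"
    using assms by (intro map_cong) auto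
  then show ?thesis
    using assms[of n] Suc by (simp only: next_state.simps lessI)
qed simp

lemma step_cong:
  assumes "\<And>i. i < t \<Longrightarrow> \<omega> i = \<omega>' i"
  shows "step \<mu> \<pi> \<kappa> t \<omega> = step \<mu> \<pi> \<kappa> t \<omega>'"
proof -
  have "map \<omega> [0..<t] = map \<omega>' [0..<t]"
    using assms by (intro map_cong) auto
  then show ?thesis
    unfolding step_def using next_state_cong[of t \<omega> \<omega>', OF assms] by (simp only:)
qed

text \<open>
  The kernel \<open>IT.eP\<close> of the Ionescu-Tulcea construction extends a past \<open>\<omega>\<close> by one sample of
  \<open>step\<close>. Seen through \<open>\<omega> \<mapsto> map \<omega> [0..<t]\<close> this is appending one element to the list, which is
  the recursion of \<open>path_law\<close>; the two monadic binds commute with the projection.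
\<close>

lemma distr_C_path_law:
  fixes \<mu> :: "'s::finite pmf" and \<pi> :: "('s, 'a::finite) policy" and \<kappa> :: "('s, 'a) adversary"
  shows "distr (IT.C \<mu> \<pi> \<kappa> 0 t (\<lambda>_. undefined)) (count_space UNIV) (\<lambda>\<omega>. map \<omega> [0..<t])
       = measure_pmf (path_law \<mu> \<pi> \<kappa> t)"
proof (induction t)
  case 0
  show ?case
    by (simp add: distr_return count_space_PiM_finite measure_pmf_bind return_pmf.rep_eq)
next
  case (Suc t)
  let ?M = "\<lambda>n. PiM {0..<n} (\<lambda>_. count_space (UNIV :: ('s \<times> 'a) set))"
  let ?C = "IT.C \<mu> \<pi> \<kappa> 0 t (\<lambda>_. undefined)"
  let ?L = "\<lambda>n \<omega>. map \<omega> [0..<n] :: ('s \<times> 'a) list"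
  let ?N = "\<lambda>l. measure_pmf (map_pmf (\<lambda>y. l @ [y]) (step \<mu> \<pi> \<kappa> t ((!) l)))"
  have L: "?L n \<in> measurable (?M n) (count_space UNIV)" for n
    by (simp add: count_space_PiM_finite)
  have u: "(\<lambda>_. undefined) \<in> space (?M 0)"
    by (simp add: space_PiM PiE_def extensional_def)
  have sets_C: "sets ?C = sets (?M t)"
    using IT.sets_C[OF u, of \<mu> \<pi> \<kappa> t] by simp
  have space_C: "space ?C = space (?M t)"
    using sets_C by (rule sets_eq_imp_space_eq)
  have ne: "space ?C \<noteq> {}"
    using space_C by (simp add: count_space_PiM_finite PiE_eq_empty_iff)
  have eP: "IT.eP \<mu> \<pi> \<kappa> t \<in> measurable ?C (subprob_algebra (?M (Suc t)))"
    unfolding measurable_cong_sets[OF sets_C refl] by (rule IT.measurable_eP)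
  have LC: "?L t \<in> measurable ?C (count_space UNIV)"
    unfolding measurable_cong_sets[OF sets_C refl] by (rule L)
  have step: "distr (IT.eP \<mu> \<pi> \<kappa> t \<omega>) (count_space UNIV) (?L (Suc t)) = ?N (?L t \<omega>)"
    if "\<omega> \<in> space ?C" for \<omega>
  proof -
    have \<omega>: "\<omega> \<in> space (?M t)" using that space_C by simp
    have "distr (IT.eP \<mu> \<pi> \<kappa> t \<omega>) (count_space UNIV) (?L (Suc t))
        = distr (step \<mu> \<pi> \<kappa> t \<omega>) (count_space UNIV) (?L (Suc t) \<circ> fun_upd \<omega> t)"
      unfolding IT.eP_def
      by (intro distr_distr L) (use \<omega> in \<open>auto simp: count_space_PiM_finite PiE_iff extensional_def\<close>)
    also have "?L (Suc t) \<circ> fun_upd \<omega> t = (\<lambda>y. ?L t \<omega> @ [y])"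
      by (auto simp: fun_eq_iff)
    also have "step \<mu> \<pi> \<kappa> t \<omega> = step \<mu> \<pi> \<kappa> t ((!) (?L t \<omega>))"
      by (rule step_cong) simp
    finally show ?thesis
      by (simp add: map_pmf_rep_eq)
  qed
  have "distr (IT.C \<mu> \<pi> \<kappa> 0 (Suc t) (\<lambda>_. undefined)) (count_space UNIV) (?L (Suc t))
      = ?C \<bind> (\<lambda>\<omega>. distr (IT.eP \<mu> \<pi> \<kappa> t \<omega>) (count_space UNIV) (?L (Suc t)))"
    unfolding IT.C.simps add_0 by (rule distr_bind[OF eP ne L])
  also have "\<dots> = ?C \<bind> (\<lambda>\<omega>. ?N (?L t \<omega>))"
    by (intro bind_cong refl step)
  also have "\<dots> = distr ?C (count_space UNIV) (?L t) \<bind> ?N"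
    by (rule bind_distr[symmetric, OF LC _ ne, where K = "count_space UNIV"])
       (simp add: measure_pmf_in_subprob_algebra)
  finally show ?case
    unfolding Suc.IH path_law.simps by (simp add: measure_pmf_bind)
qed

lemma distr_traj_law:
  fixes \<mu> :: "'s::finite pmf" and \<pi> :: "('s, 'a::finite) policy" and \<kappa> :: "('s, 'a) adversary"
  shows "distr (traj_law \<mu> \<pi> \<kappa>) (count_space UNIV) (\<lambda>\<omega>. map \<omega> [0..<t])
       = measure_pmf (path_law \<mu> \<pi> \<kappa> t)"
proof -
  let ?M = "PiM {0..<t} (\<lambda>_. count_space (UNIV :: ('s \<times> 'a) set))"
  let ?C = "\<lambda>n. IT.C \<mu> \<pi> \<kappa> 0 n (\<lambda>_. undefined)"
  have up_to: "IT.up_to {0..<t} \<le> t"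
    by (simp add: IT.up_to_iff)
  have J: "{0..<t} \<subseteq> {0..<IT.up_to {0..<t}}"
    by (rule IT.up_to) simp
  \<comment> \<open>The marginal \<open>IT.CI J\<close> is built from the first \<open>IT.up_to J\<close> coordinates,
     here exactly the first \<open>t\<close>.\<close>
  have eq: "IT.up_to {0..<t} = t"
    using up_to J by (cases "t = 0") auto
  have L: "(\<lambda>\<omega>. map \<omega> [0..<t]) \<in> measurable ?M (count_space UNIV)"
    by (simp add: count_space_PiM_finite)
  have R: "(\<lambda>\<omega>. restrict \<omega> {0..<t}) \<in> measurable (PiM I (\<lambda>_. count_space UNIV)) ?M"
    if "{0..<t} \<subseteq> I" for I :: "nat set"
    using that by (rule measurable_restrict_subset)
  have sets_C: "sets (?C t) = sets ?M"
    using IT.sets_C[of "\<lambda>_. undefined" 0 \<mu> \<pi> \<kappa> t] by simp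
  have L_restrict: "(\<lambda>\<omega>. map \<omega> [0..<t]) \<circ> (\<lambda>\<omega>. restrict \<omega> {0..<t}) = (\<lambda>\<omega>. map \<omega> [0..<t])"
    by (auto simp: fun_eq_iff)
  have "distr (traj_law \<mu> \<pi> \<kappa>) (count_space UNIV) (\<lambda>\<omega>. map \<omega> [0..<t])
      = distr (distr (IT.PF.lim \<mu> \<pi> \<kappa>) ?M (\<lambda>\<omega>. restrict \<omega> {0..<t})) (count_space UNIV) (\<lambda>\<omega>. map \<omega> [0..<t])"
    unfolding traj_law_def
    by (subst distr_distr[OF L]) (use R[of UNIV] in \<open>simp_all add: L_restrict cong: measurable_cong_sets\<close>)
  also have "\<dots> = distr (distr (?C t) ?M (\<lambda>\<omega>. restrict \<omega> {0..<t})) (count_space UNIV) (\<lambda>\<omega>. map \<omega> [0..<t])"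
    by (subst IT.distr_lim) (simp_all add: IT.CI_def eq)
  also have "\<dots> = distr (?C t) (count_space UNIV) (\<lambda>\<omega>. map \<omega> [0..<t])"
    by (subst distr_distr[OF L])
       (use R[of "{0..<t}"] sets_C in \<open>simp_all add: L_restrict cong: measurable_cong_sets\<close>)
  finally show ?thesis
    by (simp add: distr_C_path_law)
qed

lemma finite_set_path_law:
  fixes \<mu> :: "'s::finite pmf" and \<pi> :: "('s, 'a::finite) policy" and \<kappa> :: "('s, 'a) adversary"
  shows "finite (set_pmf (path_law \<mu> \<pi> \<kappa> t))"
  by (induction t) auto

lemma length_path_law: "l \<in> set_pmf (path_law \<mu> \<pi> \<kappa> t) \<Longrightarrow> length l = t"
  by (induction t arbitrary: l) auto

lemma measurable_prefix:
  fixes \<mu> :: "'s::finite pmf" and \<pi> :: "('s, 'a::finite) policy" and \<kappa> :: "('s, 'a) adversary"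
  shows "(\<lambda>\<omega>. map \<omega> [0..<n]) \<in> measurable (traj_law \<mu> \<pi> \<kappa>) (count_space UNIV)"
proof -
  have "(\<lambda>\<omega>. map \<omega> [0..<n]) \<circ> (\<lambda>\<omega>. restrict \<omega> {0..<n})
      \<in> measurable (PiM UNIV (\<lambda>_. count_space (UNIV :: ('s \<times> 'a) set))) (count_space UNIV)"
    by (rule measurable_comp[OF measurable_restrict_subset[of "{0..<n}"]])
       (simp_all add: count_space_PiM_finite)
  also have "(\<lambda>\<omega>. map \<omega> [0..<n]) \<circ> (\<lambda>\<omega>. restrict \<omega> {0..<n}) = (\<lambda>\<omega>. map \<omega> [0..<n] :: ('s \<times> 'a) list)"
    by (auto simp: fun_eq_iff)
  also have "measurable (PiM UNIV (\<lambda>_. count_space (UNIV :: ('s \<times> 'a) set))) (count_space UNIV)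
      = measurable (traj_law \<mu> \<pi> \<kappa>) (count_space (UNIV :: ('s \<times> 'a) list set))"
    unfolding traj_law_def by (intro measurable_cong_sets) (simp_all only: IT.PF.sets_lim)
  finally show ?thesis .
qed

lemma mean_reward_path_law:
  fixes \<mu> :: "'s::finite pmf" and \<pi> :: "('s, 'a::finite) policy" and \<kappa> :: "('s, 'a) adversary"
  shows "mean_reward r \<mu> \<pi> \<kappa> n =
    measure_pmf.expectation (path_law \<mu> \<pi> \<kappa> n) (\<lambda>l. \<Sum>(s, a)\<leftarrow>l. r s a) / real n"
proof -
  let ?f = "\<lambda>l. \<Sum>(s, a)\<leftarrow>l. r s a"
  have "(\<integral>l. ?f l \<partial>path_law \<mu> \<pi> \<kappa> n) = (\<integral>\<omega>. ?f (map \<omega> [0..<n]) \<partial>traj_law \<mu> \<pi> \<kappa>)"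
    unfolding distr_traj_law[symmetric] by (rule integral_distr[OF measurable_prefix]) simp
  also have "\<dots> = (\<integral>\<omega>. (\<Sum>k<n. r (fst (\<omega> k)) (snd (\<omega> k))) \<partial>traj_law \<mu> \<pi> \<kappa>)"
    by (simp add: comp_def case_prod_unfold interv_sum_list_conv_sum_set_nat atLeast0LessThan)
  finally show ?thesis
    by (simp add: mean_reward_def)
qed

section \<open>Drift of the accumulated reward\<close>

lemma expectation_bind_finite:
  fixes h :: "'b \<Rightarrow> real"
  assumes "finite (set_pmf p)" "\<And>x. x \<in> set_pmf p \<Longrightarrow> finite (set_pmf (f x))"
  shows "measure_pmf.expectation (bind_pmf p f) h =
    measure_pmf.expectation p (\<lambda>x. measure_pmf.expectation (f x) h)"
  by (subst pmf_expectation_bind[OF assms(1) assms(2)])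
     (auto simp: integral_measure_pmf[OF assms(1)])

lemma abs_expectation_le:
  fixes f :: "'b \<Rightarrow> real"
  assumes "finite (set_pmf p)" "\<And>x. \<bar>f x\<bar> \<le> B"
  shows "\<bar>measure_pmf.expectation p f\<bar> \<le> B"
proof -
  have "integrable p f"
    using assms(1) by (rule integrable_measure_pmf_finite)
  moreover have "- B \<le> f x" "f x \<le> B" for x
    using assms(2)[of x] by auto
  ultimately have "- B \<le> measure_pmf.expectation p f" "measure_pmf.expectation p f \<le> B"
    by (auto intro!: measure_pmf.integral_ge_const measure_pmf.integral_le_const)
  then show ?thesis
    by simp
qed

text \<open>
  The right-hand side of the optimality equations without the constant \<open>\<alpha>\<close>, and for arbitrary
  real rewards, so that \<open>r\<close> and \<open>u\<close> may be negated when the roles of the players are exchanged.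
\<close>

definition action_value ::
  "('s \<Rightarrow> 'a \<Rightarrow> real) \<Rightarrow> ('s \<Rightarrow> real) \<Rightarrow> 's \<Rightarrow> 'a pmf \<Rightarrow> ('a \<Rightarrow> 's pmf) \<Rightarrow> real" where
  "action_value r u s \<phi> p =
     measure_pmf.expectation \<phi> (\<lambda>a. r s a + measure_pmf.expectation (p a) u)"

lemma action_value_uminus:
  fixes p :: "'a::finite \<Rightarrow> 's::finite pmf"
  shows "action_value (\<lambda>s a. - r s a) (\<lambda>s. - u s) s \<phi> p = - action_value r u s \<phi> p"
  unfolding action_value_def by (simp flip: integral_minus)

lemma bellman_sum_eq:
  fixes p :: "'a::finite \<Rightarrow> 's::finite pmf"
  shows "(\<Sum>a\<in>UNIV. \<Sum>s'\<in>UNIV. pmf \<phi> a * pmf (p a) s' * (r s a - \<alpha> + u s'))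
       = action_value r u s \<phi> p - \<alpha>"
proof -
  have "(\<Sum>s'\<in>UNIV. pmf \<phi> a * pmf (p a) s' * (r s a - \<alpha> + u s'))
      = pmf \<phi> a * (r s a + measure_pmf.expectation (p a) u) - pmf \<phi> a * \<alpha>" for a
  proof -
    have "(\<Sum>s'\<in>UNIV. pmf \<phi> a * pmf (p a) s' * (r s a - \<alpha> + u s'))
       = pmf \<phi> a * (\<Sum>s'\<in>UNIV. pmf (p a) s') * (r s a - \<alpha>) + pmf \<phi> a * (\<Sum>s'\<in>UNIV. pmf (p a) s' * u s')"
      by (simp add: sum_distrib_left sum_distrib_right distrib_left sum.distrib mult.assoc)
    then show ?thesis
      by (simp add: sum_pmf_eq_1 integral_measure_pmf[of UNIV] algebra_simps)
  qed
  then show ?thesis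
    by (simp add: action_value_def integral_measure_pmf[of UNIV] sum_subtractf sum_pmf_eq_1
             flip: sum_distrib_right)
qed

text \<open>
  \<open>V n\<close> is the expected reward of the first \<open>n\<close> steps plus the expected potential of \<open>X\<^sub>n\<close>. A prefix
  of length \<open>n\<close> contains only \<open>X\<^sub>0, \<dots>, X\<^sub>n\<^sub>-\<^sub>1\<close>, hence the inner expectation over the
  conditional law of \<open>X\<^sub>n\<close>. Conditioning \<open>V (Suc n)\<close> on the prefix of length \<open>n\<close> and on \<open>X\<^sub>n = x\<close>
  replaces \<open>u x\<close> by the action value at the history \<open>(l, x)\<close>, which the hypothesis bounds.
\<close>

lemma drift_step:
  fixes \<mu> :: "'s::finite pmf" and \<pi> :: "('s, 'a::finite) policy" and \<kappa> :: "('s, 'a) adversary"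
  assumes drift: "\<And>h. u (snd h) + \<beta> \<le> action_value r u (snd h) (\<pi> h) (\<kappa> h)"
  defines "V \<equiv> \<lambda>n. measure_pmf.expectation (path_law \<mu> \<pi> \<kappa> n)
    (\<lambda>l. (\<Sum>(s, a)\<leftarrow>l. r s a) + measure_pmf.expectation (next_state \<mu> \<kappa> n ((!) l)) u)"
  shows "V n + \<beta> \<le> V (Suc n)"
proof -
  let ?E = "measure_pmf.expectation"
  let ?R = "\<lambda>l. \<Sum>(s, a)\<leftarrow>l. r s a"
  let ?X = "\<lambda>l. next_state \<mu> \<kappa> n ((!) l)"
  note [simp] = integrable_measure_pmf_finite finite_set_path_law
  have "V (Suc n) = ?E (path_law \<mu> \<pi> \<kappa> n) (\<lambda>l. ?E (step \<mu> \<pi> \<kappa> n ((!) l))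
      (\<lambda>y. ?R l + r (fst y) (snd y) + ?E (next_state \<mu> \<kappa> (Suc n) ((!) (l @ [y]))) u))"
    unfolding V_def path_law.simps
    by (subst expectation_bind_finite) (auto simp: case_prod_unfold)
  also have "\<dots> = ?E (path_law \<mu> \<pi> \<kappa> n)
      (\<lambda>l. ?E (?X l) (\<lambda>x. ?R l + action_value r u x (\<pi> (l, x)) (\<kappa> (l, x))))"
  proof (intro integral_cong_AE)
    have "?E (step \<mu> \<pi> \<kappa> n ((!) l))
        (\<lambda>y. ?R l + r (fst y) (snd y) + ?E (next_state \<mu> \<kappa> (Suc n) ((!) (l @ [y]))) u)
      = ?E (?X l) (\<lambda>x. ?R l + action_value r u x (\<pi> (l, x)) (\<kappa> (l, x)))"
      if "length l = n" for l
    proof -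
      have [simp]: "map ((!) l) [0..<n] = l" "map ((!) (l @ [y])) [0..<n] = l" for y
        using that by (auto intro!: nth_equalityI simp: nth_append)
      show ?thesis
        using that unfolding step_def
        by (subst expectation_bind_finite) (simp_all add: action_value_def add.assoc nth_append)
    qed
    then show "AE l in path_law \<mu> \<pi> \<kappa> n. ?E (step \<mu> \<pi> \<kappa> n ((!) l))
        (\<lambda>y. ?R l + r (fst y) (snd y) + ?E (next_state \<mu> \<kappa> (Suc n) ((!) (l @ [y]))) u)
      = ?E (?X l) (\<lambda>x. ?R l + action_value r u x (\<pi> (l, x)) (\<kappa> (l, x)))"
      by (auto simp: AE_measure_pmf_iff dest: length_path_law)
  qed simp_all
  also have "\<dots> \<ge> ?E (path_law \<mu> \<pi> \<kappa> n) (\<lambda>l. ?E (?X l) (\<lambda>x. ?R l + (u x + \<beta>)))"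
    by (intro integral_mono add_left_mono) (use drift in \<open>auto simp: dest: spec\<close>)
  also have "?E (path_law \<mu> \<pi> \<kappa> n) (\<lambda>l. ?E (?X l) (\<lambda>x. ?R l + (u x + \<beta>))) = V n + \<beta>"
    by (simp add: V_def flip: add.assoc)
  finally show ?thesis .
qed

text \<open>
  The potential enters the telescoped sum only at the times \<open>0\<close> and \<open>n\<close>, at a cost of at most \<open>2 * K\<close>.
\<close>

lemma drift_mean_reward:
  fixes \<mu> :: "'s::finite pmf" and \<pi> :: "('s, 'a::finite) policy" and \<kappa> :: "('s, 'a) adversary"
  assumes drift: "\<And>h. u (snd h) + \<beta> \<le> action_value r u (snd h) (\<pi> h) (\<kappa> h)"
    and u: "\<And>s. \<bar>u s\<bar> \<le> K" and n: "n > 0"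
  shows "\<beta> - 2 * K / real n \<le> mean_reward r \<mu> \<pi> \<kappa> n"
proof -
  let ?E = "measure_pmf.expectation"
  let ?W = "\<lambda>n. ?E (path_law \<mu> \<pi> \<kappa> n) (\<lambda>l. \<Sum>(s, a)\<leftarrow>l. r s a)"
  let ?U = "\<lambda>n. ?E (path_law \<mu> \<pi> \<kappa> n) (\<lambda>l. ?E (next_state \<mu> \<kappa> n ((!) l)) u)"
  note [simp] = integrable_measure_pmf_finite finite_set_path_law
  have U: "\<bar>?U n\<bar> \<le> K" for n
    by (intro abs_expectation_le) (simp_all add: u)
  have "?U 0 + real n * \<beta> \<le> ?W n + ?U n"
  proof (induction n)
    case (Suc n)
    then show ?case
      using drift_step[of u \<beta> r \<pi> \<kappa> \<mu> n, OF drift] by (simp add: algebra_simps)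
  qed simp
  then have "real n * \<beta> - 2 * K \<le> ?W n"
    using U[of 0] U[of n] by linarith
  then show ?thesis
    using n by (simp add: mean_reward_path_law pos_le_divide_eq left_diff_distrib mult.commute[of \<beta>])
qed

lemma drift_lower_avg:
  fixes \<mu> :: "'s::finite pmf" and \<pi> :: "('s, 'a::finite) policy" and \<kappa> :: "('s, 'a) adversary"
  assumes drift: "\<And>h. u (snd h) + \<beta> \<le> action_value r u (snd h) (\<pi> h) (\<kappa> h)"
  shows "ereal \<beta> \<le> lower_avg r \<mu> \<pi> \<kappa>"
proof -
  define K where "K = Max (range (\<lambda>s. \<bar>u s\<bar>))"
  have K: "\<bar>u s\<bar> \<le> K" for s
    unfolding K_def by (rule Max_ge) auto
  have "(\<lambda>n. \<beta> - 2 * K / real n) \<longlonglongrightarrow> \<beta> - 0"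
    by (intro tendsto_diff tendsto_const lim_const_over_n)
  then have "(\<lambda>n. ereal (\<beta> - 2 * K / real n)) \<longlonglongrightarrow> ereal \<beta>"
    by simp
  then have "ereal \<beta> = liminf (\<lambda>n. ereal (\<beta> - 2 * K / real n))"
    by (intro lim_imp_Liminf[symmetric]) simp_all
  also have "\<dots> \<le> lower_avg r \<mu> \<pi> \<kappa>"
    unfolding lower_avg_def
  proof (rule Liminf_mono)
    show "\<forall>\<^sub>F n in sequentially. ereal (\<beta> - 2 * K / real n) \<le> ereal (mean_reward r \<mu> \<pi> \<kappa> n)"
      using eventually_gt_at_top[of 0]
      by eventually_elim (use drift_mean_reward[OF drift K] in simp)
  qed
  finally show ?thesis .
qed

lemma lower_avg_uminus:
  fixes \<mu> :: "'s::finite pmf" and \<pi> :: "('s, 'a::finite) policy" and \<kappa> :: "('s, 'a) adversary"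
  shows "lower_avg (\<lambda>s a. - r s a) \<mu> \<pi> \<kappa> = - upper_avg r \<mu> \<pi> \<kappa>"
proof -
  have "mean_reward (\<lambda>s a. - r s a) \<mu> \<pi> \<kappa> n = - mean_reward r \<mu> \<pi> \<kappa> n" for n
    by (simp add: mean_reward_def sum_negf)
  then show ?thesis
    by (simp add: lower_avg_def upper_avg_def ereal_Liminf_uminus flip: uminus_ereal.simps)
qed

lemma drift_upper_avg:
  fixes \<mu> :: "'s::finite pmf" and \<pi> :: "('s, 'a::finite) policy" and \<kappa> :: "('s, 'a) adversary"
  assumes "\<And>h. action_value r u (snd h) (\<pi> h) (\<kappa> h) \<le> u (snd h) + \<beta>"
  shows "upper_avg r \<mu> \<pi> \<kappa> \<le> ereal \<beta>"
proof -
  have "- u (snd h) + - \<beta> \<le> action_value (\<lambda>s a. - r s a) (\<lambda>s. - u s) (snd h) (\<pi> h) (\<kappa> h)" for h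
    using assms[of h] by (simp only: action_value_uminus)
  then have "ereal (- \<beta>) \<le> lower_avg (\<lambda>s a. - r s a) \<mu> \<pi> \<kappa>"
    by (rule drift_lower_avg)
  then show ?thesis
    by (simp add: lower_avg_uminus ereal_minus_le_minus flip: uminus_ereal.simps)
qed

section \<open>Near-optimal stationary strategies\<close>

text \<open>
  On the reals, \<open>SUP\<close> and \<open>INF\<close> bound their members only for bounded families. One bound for
  all \<open>\<phi>\<close> and \<open>p\<close> at once takes care of the arbitrary sets \<open>Q\<close> and \<open>P s\<close>.
\<close>

lemma bounded_action_value:
  fixes r :: "'s::finite \<Rightarrow> 'a::finite \<Rightarrow> real"
  obtains B where "\<And>s \<phi> p. \<bar>action_value r u s \<phi> p\<bar> \<le> B"
proof -
  define K where "K = Max (range (\<lambda>s. \<bar>u s\<bar>))"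
  define R where "R = Max (range (\<lambda>(s, a). \<bar>r s a\<bar>))"
  note [simp] = integrable_measure_pmf_finite
  have K: "\<bar>u s\<bar> \<le> K" for s
    unfolding K_def by (rule Max_ge) auto
  have R: "\<bar>r s a\<bar> \<le> R" for s a
    unfolding R_def by (rule Max_ge) (auto intro: range_eqI[of _ _ "(s, a)"])
  have "\<bar>action_value r u s \<phi> p\<bar> \<le> R + K" for s \<phi> and p :: "'a \<Rightarrow> 's pmf"
    unfolding action_value_def
    by (intro abs_expectation_le order_trans[OF abs_triangle_ineq] add_mono R K) simp_all
  then show ?thesis
    by (rule that)
qed

lemma near_optimal_SUP_INF:
  fixes f :: "'a \<Rightarrow> 'b \<Rightarrow> real"
  assumes "X \<noteq> {}" and B: "\<And>x y. \<bar>f x y\<bar> \<le> B" and "0 < \<epsilon>"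
  shows "\<exists>x\<in>X. \<forall>y\<in>Y. (SUP x\<in>X. INF y\<in>Y. f x y) - \<epsilon> \<le> f x y"
proof -
  have "(SUP x\<in>X. INF y\<in>Y. f x y) - \<epsilon> < (SUP x\<in>X. INF y\<in>Y. f x y)"
    using \<open>0 < \<epsilon>\<close> by simp
  from less_cSupD[OF _ this] obtain x
    where x: "x \<in> X" "(SUP x\<in>X. INF y\<in>Y. f x y) - \<epsilon> < (INF y\<in>Y. f x y)"
    using \<open>X \<noteq> {}\<close> by auto
  have "bdd_below (f x ` Y)"
    using B by (intro bdd_belowI2[of _ "- B"]) (auto simp: abs_le_iff minus_le_iff)
  then show ?thesis
    using x cINF_lower[of "f x" Y] by (intro bexI[of _ x]) fastforce+
qed

lemma near_optimal_INF_SUP: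
  fixes f :: "'a \<Rightarrow> 'b \<Rightarrow> real"
  assumes "Y \<noteq> {}" and B: "\<And>x y. \<bar>f x y\<bar> \<le> B" and "0 < \<epsilon>"
  shows "\<exists>y\<in>Y. \<forall>x\<in>X. f x y \<le> (INF y\<in>Y. SUP x\<in>X. f x y) + \<epsilon>"
proof -
  have "(INF y\<in>Y. SUP x\<in>X. f x y) < (INF y\<in>Y. SUP x\<in>X. f x y) + \<epsilon>"
    using \<open>0 < \<epsilon>\<close> by simp
  from cInf_lessD[OF _ this] obtain y
    where y: "y \<in> Y" "(SUP x\<in>X. f x y) < (INF y\<in>Y. SUP x\<in>X. f x y) + \<epsilon>"
    using \<open>Y \<noteq> {}\<close> by auto
  have "bdd_above ((\<lambda>x. f x y) ` X)"
    using B by (intro bdd_aboveI2[of _ _ B]) (auto simp: abs_le_iff)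
  then show ?thesis
    using y cSUP_upper[of _ X "\<lambda>x. f x y"] by (intro bexI[of _ y]) fastforce+
qed

text \<open>
  A single choice per state suffices: whatever the adversary does after the history \<open>h\<close>, its
  kernel lies in \<open>P (snd h)\<close>, against which \<open>\<Delta> (snd h)\<close> was chosen.
\<close>

lemma near_optimal_stationary_policy:
  fixes r :: "'s::finite \<Rightarrow> 'a::finite \<Rightarrow> real"
  assumes "Q \<noteq> {}" "0 < \<epsilon>"
    and u: "\<And>s. u s = (SUP \<phi>\<in>Q. INF p\<in>P s. action_value r u s \<phi> p - \<alpha>)"
  obtains \<pi> where "\<pi> \<in> stationary_policies Q"
    "\<And>\<kappa> \<mu>. \<kappa> \<in> history_adversaries P \<Longrightarrow> ereal (\<alpha> - \<epsilon>) \<le> lower_avg r \<mu> \<pi> \<kappa>"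
proof -
  obtain B where B: "\<And>s \<phi> p. \<bar>action_value r u s \<phi> p\<bar> \<le> B"
    using bounded_action_value[of r u] by blast
  have B': "\<bar>action_value r u s \<phi> p - \<alpha>\<bar> \<le> B + \<bar>\<alpha>\<bar>" for s \<phi> p
    using B[of s \<phi> p] by linarith
  have "\<exists>\<phi>\<in>Q. \<forall>p\<in>P s. u s - \<epsilon> \<le> action_value r u s \<phi> p - \<alpha>" for s
    using near_optimal_SUP_INF[where f = "\<lambda>\<phi> p. action_value r u s \<phi> p - \<alpha>" and Y = "P s",
        OF \<open>Q \<noteq> {}\<close> B' \<open>0 < \<epsilon>\<close>]
    unfolding u[of s, symmetric] .
  then obtain \<Delta> where \<Delta>: "\<And>s. \<Delta> s \<in> Q"
    "\<And>s p. p \<in> P s \<Longrightarrow> u s - \<epsilon> \<le> action_value r u s (\<Delta> s) p - \<alpha>"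
    by metis
  show ?thesis
  proof (rule that)
    show "(\<lambda>h. \<Delta> (snd h)) \<in> stationary_policies Q"
      using \<Delta>(1) by (auto simp: stationary_policies_def)
    show "ereal (\<alpha> - \<epsilon>) \<le> lower_avg r \<mu> (\<lambda>h. \<Delta> (snd h)) \<kappa>"
      if "\<kappa> \<in> history_adversaries P" for \<kappa> \<mu>
    proof (rule drift_lower_avg)
      show "u (snd h) + (\<alpha> - \<epsilon>) \<le> action_value r u (snd h) (\<Delta> (snd h)) (\<kappa> h)" for h
      proof -
        have "\<kappa> h \<in> P (snd h)"
          using that unfolding history_adversaries_def by blast
        from \<Delta>(2)[OF this] show ?thesis
          by linarith
      qed
    qed
  qed
qed

lemma near_optimal_stationary_adversary:
  fixes r :: "'s::finite \<Rightarrow> 'a::finite \<Rightarrow> real"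
  assumes P: "\<And>s. P s \<noteq> {}" and "0 < \<epsilon>"
    and u: "\<And>s. u s = (INF p\<in>P s. SUP \<phi>\<in>Q. action_value r u s \<phi> p - \<alpha>)"
  obtains \<kappa> where "\<kappa> \<in> stationary_adversaries P"
    "\<And>\<pi> \<mu>. \<pi> \<in> history_policies Q \<Longrightarrow> upper_avg r \<mu> \<pi> \<kappa> \<le> ereal (\<alpha> + \<epsilon>)"
proof -
  obtain B where B: "\<And>s \<phi> p. \<bar>action_value r u s \<phi> p\<bar> \<le> B"
    using bounded_action_value[of r u] by blast
  have B': "\<bar>action_value r u s \<phi> p - \<alpha>\<bar> \<le> B + \<bar>\<alpha>\<bar>" for s \<phi> p
    using B[of s \<phi> p] by linarith
  have "\<exists>p\<in>P s. \<forall>\<phi>\<in>Q. action_value r u s \<phi> p - \<alpha> \<le> u s + \<epsilon>" for s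
    using near_optimal_INF_SUP[where f = "\<lambda>\<phi> p. action_value r u s \<phi> p - \<alpha>" and X = Q,
        OF P[of s] B' \<open>0 < \<epsilon>\<close>]
    unfolding u[of s, symmetric] .
  then obtain p where p: "\<And>s. p s \<in> P s"
    "\<And>s \<phi>. \<phi> \<in> Q \<Longrightarrow> action_value r u s \<phi> (p s) - \<alpha> \<le> u s + \<epsilon>"
    by metis
  show ?thesis
  proof (rule that)
    show "(\<lambda>h. p (snd h)) \<in> stationary_adversaries P"
      using p(1) by (auto simp: stationary_adversaries_def)
    show "upper_avg r \<mu> \<pi> (\<lambda>h. p (snd h)) \<le> ereal (\<alpha> + \<epsilon>)"
      if "\<pi> \<in> history_policies Q" for \<pi> \<mu>
    proof (rule drift_upper_avg)
      show "action_value r u (snd h) (\<pi> h) (p (snd h)) \<le> u (snd h) + (\<alpha> + \<epsilon>)" for h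
      proof -
        have "\<pi> h \<in> Q"
          using that unfolding history_policies_def by blast
        from p(2)[OF this, of "snd h"] show ?thesis
          by linarith
      qed
    qed
  qed
qed

lemma SUP_INF_le_INF_SUP:
  fixes f :: "'a \<Rightarrow> 'b \<Rightarrow> 'c::complete_lattice"
  shows "(SUP x\<in>X. INF y\<in>Y. f x y) \<le> (INF y\<in>Y. SUP x\<in>X. f x y)"
proof (intro SUP_least INF_greatest)
  fix x y assume "x \<in> X" "y \<in> Y"
  then have "(INF y\<in>Y. f x y) \<le> f x y" "f x y \<le> (SUP x\<in>X. f x y)"
    by (auto intro: INF_lower SUP_upper)
  then show "(INF y\<in>Y. f x y) \<le> (SUP x\<in>X. f x y)"
    by (rule order_trans)
qed

section \<open>The value of the average-reward game\<close>

theorem theorem2: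
  fixes r :: "'s::finite \<Rightarrow> 'a::finite \<Rightarrow> real"
    and Q :: "'a pmf set"
    and P :: "'s \<Rightarrow> ('a \<Rightarrow> 's pmf) set"
    and u :: "'s \<Rightarrow> real"
    and \<alpha> :: real
    and \<mu> :: "'s pmf"
    and Pol :: "('s, 'a) policy set"
    and Adv :: "('s, 'a) adversary set"
  assumes r: "\<And>s a. r s a \<in> {0..1}"
    and Q: "Q \<noteq> {}"
    and P: "\<And>s. P s \<noteq> {}"
    and \<alpha>: "\<alpha> \<in> {0..1}"
    and sup_inf: "\<And>s. u s = (SUP \<phi>\<in>Q. INF p\<in>P s. \<Sum>a\<in>UNIV. \<Sum>s'\<in>UNIV.
                      pmf \<phi> a * pmf (p a) s' * (r s a - \<alpha> + u s'))"
    and inf_sup: "\<And>s. u s = (INF p\<in>P s. SUP \<phi>\<in>Q. \<Sum>a\<in>UNIV. \<Sum>s'\<in>UNIV.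
                      pmf \<phi> a * pmf (p a) s' * (r s a - \<alpha> + u s'))"
    and Pol: "Pol \<in> {history_policies Q, stationary_policies Q}"
    and Adv: "Adv \<in> {history_adversaries P, stationary_adversaries P}"
  shows "(SUP \<pi>\<in>Pol. INF \<kappa>\<in>Adv. upper_avg r \<mu> \<pi> \<kappa>) = ereal \<alpha>
       \<and> (INF \<kappa>\<in>Adv. SUP \<pi>\<in>Pol. upper_avg r \<mu> \<pi> \<kappa>) = ereal \<alpha>
       \<and> (SUP \<pi>\<in>Pol. INF \<kappa>\<in>Adv. lower_avg r \<mu> \<pi> \<kappa>) = ereal \<alpha>
       \<and> (INF \<kappa>\<in>Adv. SUP \<pi>\<in>Pol. lower_avg r \<mu> \<pi> \<kappa>) = ereal \<alpha>"
proof -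
  let ?SIl = "SUP \<pi>\<in>Pol. INF \<kappa>\<in>Adv. lower_avg r \<mu> \<pi> \<kappa>"
  let ?SIu = "SUP \<pi>\<in>Pol. INF \<kappa>\<in>Adv. upper_avg r \<mu> \<pi> \<kappa>"
  let ?ISl = "INF \<kappa>\<in>Adv. SUP \<pi>\<in>Pol. lower_avg r \<mu> \<pi> \<kappa>"
  let ?ISu = "INF \<kappa>\<in>Adv. SUP \<pi>\<in>Pol. upper_avg r \<mu> \<pi> \<kappa>"
  have Pol': "stationary_policies Q \<subseteq> Pol" "Pol \<subseteq> history_policies Q"
    using Pol by (auto simp: stationary_policies_def history_policies_def)
  have Adv': "stationary_adversaries P \<subseteq> Adv" "Adv \<subseteq> history_adversaries P"
    using Adv by (auto simp: stationary_adversaries_def history_adversaries_def)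
  have lower: "ereal \<alpha> \<le> ?SIl"
  proof (rule ereal_le_epsilon2)
    fix \<epsilon> :: real assume "0 < \<epsilon>"
    from near_optimal_stationary_policy[OF Q this sup_inf[unfolded bellman_sum_eq]]
    obtain \<pi> where \<pi>: "\<pi> \<in> stationary_policies Q"
      "\<And>\<kappa> \<mu>. \<kappa> \<in> history_adversaries P \<Longrightarrow> ereal (\<alpha> - \<epsilon>) \<le> lower_avg r \<mu> \<pi> \<kappa>"
      by blast
    have "ereal (\<alpha> - \<epsilon>) \<le> ?SIl"
      using \<pi> Pol' Adv' by (intro SUP_upper2[of \<pi>] INF_greatest) auto
    then have "ereal (\<alpha> - \<epsilon>) + ereal \<epsilon> \<le> ?SIl + ereal \<epsilon>"
      by (rule add_right_mono)
    then show "ereal \<alpha> \<le> ?SIl + ereal \<epsilon>"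
      by simp
  qed
  have upper: "?ISu \<le> ereal \<alpha>"
  proof (rule ereal_le_epsilon2)
    fix \<epsilon> :: real assume "0 < \<epsilon>"
    from near_optimal_stationary_adversary[OF P this inf_sup[unfolded bellman_sum_eq]]
    obtain \<kappa> where \<kappa>: "\<kappa> \<in> stationary_adversaries P"
      "\<And>\<pi> \<mu>. \<pi> \<in> history_policies Q \<Longrightarrow> upper_avg r \<mu> \<pi> \<kappa> \<le> ereal (\<alpha> + \<epsilon>)"
      by blast
    have "?ISu \<le> ereal (\<alpha> + \<epsilon>)"
      using \<kappa> Pol' Adv' by (intro INF_lower2[of \<kappa>] SUP_least) auto
    then show "?ISu \<le> ereal \<alpha> + ereal \<epsilon>"
      by simp
  qed
  have le: "lower_avg r \<mu> \<pi> \<kappa> \<le> upper_avg r \<mu> \<pi> \<kappa>" for \<pi> \<kappa>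
    unfolding lower_avg_def upper_avg_def by (rule Liminf_le_Limsup) simp
  have "?SIl \<le> ?SIu"
    by (intro SUP_mono' INF_mono' le)
  moreover have "?ISl \<le> ?ISu"
    by (intro SUP_mono' INF_mono' le)
  moreover have "?SIu \<le> ?ISu" "?SIl \<le> ?ISl"
    by (rule SUP_INF_le_INF_SUP)+
  ultimately show ?thesis
    using lower upper by (auto intro!: antisym elim: order_trans)
qed

end
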